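(* Let $B\in\mathbb{Q}^{n\times m}$ have rank $n$ ($m\ge n$), let $P,R_w\in\mathbb{R}^{n\times n}$ be symmetric positive definite, $Q=P^{-1}$, $\mathcal W=\{w\in\mathbb{R}^n: w^TR_ww\le1\}$, $\mathcal U=\{u\in\mathbb{R}^m: u^-\le u\le u^+\}$ with $u^-,u^+\in\mathbb{R}^m$, $u^-<0<u^+$ componentwise, $k\in\mathbb{R}$, and $H\in\mathbb{R}^{m\times n}$ with $BH=I$. Let $x(0)\in\mathbb{R}^n$ be an initial state with $\xi:=x(0)^TPx(0)\ge1$, and let $A_j$, $j=1,\dots,2^m$, be the matrices defined in the context. If there exists a scalar $\alpha>0$ such that $$M_j:=QA_j^T+A_jQ+\alpha Q+\frac1\alpha R_w^{-1}<0\qquad\text{(negative definite) for all } j=1,\dots,2^m,$$ then the saturated linear state feedback control $u_i=sat_{[u_i^-,u_i^+]}\{-kH_{i\bullet}x\}$, $i=1,\dots,m$, drives the state $x(t)$ of the system $\dot x(t)=Bu(t)-w(t)$, $w(t)\in\mathcal W$, from $x(0)$ within the target set $\Pi=\{x\in\mathbb{R}^n: x^TPx\le1\}$.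
   Context: $H_{i\bullet}$ is the $i$th row of $H$; $sat_{[a,b]}\{\zeta\}$ equals $b$ if $\zeta>b$, $\zeta$ if $a\le\zeta\le b$, and $a$ if $\zeta<a$. "Drives the state within $\Pi$" means: for every (measurable) demand $w:[0,\infty)\to\mathcal W$, the closed-loop trajectory from $x(0)$ converges to $\Pi$, i.e. $\mathrm{dist}(x(t),\Pi)\to0$ as $t\to\infty$. Degrees of saturation: for $x\in\mathbb{R}^n$, $$\theta_i(x)=\begin{cases}\dfrac{u_i^-}{-kH_{i\bullet}x} & \text{if } -kH_{i\bullet}x<u_i^-,\\ 1 & \text{if } u_i^-\le -kH_{i\bullet}x\le u_i^+,\\ \dfrac{u_i^+}{-kH_{i\bullet}x} & \text{if } -kH_{i\bullet}x>u_i^+.\end{cases}$$ Let $\Sigma_0(\xi)=\{x\in\mathbb{R}^n: x^TPx\le\xi\}$ and $\underline\theta_i=\min_{x\in\Sigma_0(\xi)}\theta_i(x)\in(0,1]$. Let $\gamma_1,\dots,\gamma_{2^m}$ be the $2^m$ vectors of $\{1,\underline\theta_1\}\times\cdots\times\{1,\underline\theta_m\}$ (one for each choice, per component, of $1$ or $\underline\theta_i$), and define $A_j=-kB\,\mathrm{diag}(\gamma_j)\,H$. *)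

theory Defs
  imports "HOL-Analysis.Analysis"
begin

definition quad_form :: "real^'n^'n \<Rightarrow> real^'n \<Rightarrow> real" where
  "quad_form A x = x \<bullet> (A *v x)"

definition sym_pos_def :: "real^'n^'n \<Rightarrow> bool" where
  "sym_pos_def A \<longleftrightarrow> transpose A = A \<and> (\<forall>x. x \<noteq> 0 \<longrightarrow> quad_form A x > 0)"

definition sym_neg_def :: "real^'n^'n \<Rightarrow> bool" where
  "sym_neg_def A \<longleftrightarrow> transpose A = A \<and> (\<forall>x. x \<noteq> 0 \<longrightarrow> quad_form A x < 0)"

definition ellipsoid :: "real^'n^'n \<Rightarrow> real \<Rightarrow> (real^'n) set" where
  "ellipsoid A c = {x. quad_form A x \<le> c}"

definition diag_mat :: "real^'m \<Rightarrow> real^'m^'m" where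
  "diag_mat d = (\<chi> i j. if i = j then d $ i else 0)"

definition sat :: "real \<Rightarrow> real \<Rightarrow> real \<Rightarrow> real" where
  "sat a b z = (if z > b then b else if a \<le> z then z else a)"

definition sat_feedback ::
  "real \<Rightarrow> real^'n^'m \<Rightarrow> real^'m \<Rightarrow> real^'m \<Rightarrow> real^'n \<Rightarrow> real^'m" where
  "sat_feedback k H umin umax x =
     (\<chi> i. sat (umin $ i) (umax $ i) (- k * (row i H \<bullet> x)))"

lemma sat_feedback_in_cbox:
  assumes "\<forall>i. umin $ i < 0 \<and> 0 < umax $ i"
  shows "sat_feedback k H umin umax x \<in> cbox umin umax"
proof -
  have "umin $ i \<le> umax $ i" for i
    using assms by (meson less_imp_le order_trans)
  then show ?thesis
    by (auto simp: mem_box_cart sat_feedback_def sat_def)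
qed

definition sat_degree ::
  "real \<Rightarrow> real^'n^'m \<Rightarrow> real^'m \<Rightarrow> real^'m \<Rightarrow> 'm \<Rightarrow> real^'n \<Rightarrow> real" where
  "sat_degree k H umin umax i x =
     (let z = - k * (row i H \<bullet> x) in
      if z < umin $ i then umin $ i / z
      else if z \<le> umax $ i then 1
      else umax $ i / z)"

(* LEAST is the actual minimum: sat_degree is continuous in x and, for P positive definite
   and \<xi> \<ge> 0, the ellipsoid is compact and nonempty. *)
definition min_sat_degree ::
  "real \<Rightarrow> real^'n^'m \<Rightarrow> real^'m \<Rightarrow> real^'m \<Rightarrow> real^'n^'n \<Rightarrow> real \<Rightarrow> 'm \<Rightarrow> real" where
  "min_sat_degree k H umin umax P \<xi> i =
     (LEAST v. v \<in> sat_degree k H umin umax i ` ellipsoid P \<xi>)"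

(* The 2^m vertices are indexed by the sets J :: 'm set of those components that take
   the value min_sat_degree instead of 1. *)
definition vertex_gain ::
  "real \<Rightarrow> real^'n^'m \<Rightarrow> real^'m \<Rightarrow> real^'m \<Rightarrow> real^'n^'n \<Rightarrow> real \<Rightarrow> 'm set \<Rightarrow> real^'m" where
  "vertex_gain k H umin umax P \<xi> J =
     (\<chi> i. if i \<in> J then min_sat_degree k H umin umax P \<xi> i else 1)"

definition vertex_matrix ::
  "real^'m^'n \<Rightarrow> real \<Rightarrow> real^'n^'m \<Rightarrow> real^'m \<Rightarrow> real^'m \<Rightarrow> real^'n^'n \<Rightarrow> real \<Rightarrow> 'm set
    \<Rightarrow> real^'n^'n" where
  "vertex_matrix B k H umin umax P \<xi> J =
     (- k) *\<^sub>R (B ** diag_mat (vertex_gain k H umin umax P \<xi> J) ** H)"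

definition demand :: "(real^'n) set \<Rightarrow> (real \<Rightarrow> real^'n) \<Rightarrow> bool" where
  "demand W w \<longleftrightarrow> w \<in> borel_measurable (lebesgue_on {0..}) \<and> (\<forall>t\<ge>0. w t \<in> W)"

(* x' = B u - w on [0,\<infinity>) in the sense of Caratheodory (w is merely measurable, so the
   differential equation is stated in integrated form). *)
definition is_trajectory ::
  "real^'m^'n \<Rightarrow> (real \<Rightarrow> real^'m) \<Rightarrow> (real \<Rightarrow> real^'n) \<Rightarrow> real^'n \<Rightarrow> (real \<Rightarrow> real^'n) \<Rightarrow> bool" where
  "is_trajectory B u w x0 x \<longleftrightarrow>
     continuous_on {0..} x \<and> x 0 = x0 \<and>
     (\<forall>t\<ge>0. ((\<lambda>s. B *v u s - w s) has_integral (x t - x0)) {0..t})"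

definition is_closed_loop_trajectory ::
  "real^'m^'n \<Rightarrow> (real^'n \<Rightarrow> real^'m) \<Rightarrow> (real \<Rightarrow> real^'n) \<Rightarrow> real^'n \<Rightarrow> (real \<Rightarrow> real^'n) \<Rightarrow> bool" where
  "is_closed_loop_trajectory B \<phi> w x0 x \<longleftrightarrow> is_trajectory B (\<lambda>t. \<phi> (x t)) w x0 x"

(* The existence conjunct excludes a vacuous reading of the convergence conjunct. *)
definition drives_within ::
  "real^'m^'n \<Rightarrow> (real^'n \<Rightarrow> real^'m) \<Rightarrow> (real^'n) set \<Rightarrow> real^'n \<Rightarrow> (real^'n) set \<Rightarrow> bool" where
  "drives_within B \<phi> W x0 S \<longleftrightarrow>
     (\<forall>w. demand W w \<longrightarrow>
        (\<exists>x. is_closed_loop_trajectory B \<phi> w x0 x) \<and>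
        (\<forall>x. is_closed_loop_trajectory B \<phi> w x0 x \<longrightarrow>
           ((\<lambda>t. infdist (x t) S) \<longlongrightarrow> 0) at_top))"

end

(* For x in the ellipsoid Sigma_0(xi) the saturated input equals A x with A in the convex hull of
   the vertex matrices. With z = P x, the LMI at the worst vertex and Young's inequality for
   the demand term give V' < alpha (1 - V) along trajectories as long as 1 <= V <= xi, where
   V = x^T P x. Hence V(t) <= 1 + (xi - 1) exp(-alpha t), which simultaneously keeps the state in
   Sigma_0(xi) and forces convergence to the target ellipsoid. Trajectories exist because the
   saturated feedback is bounded and globally Lipschitz. *)

theory Submission
  imports Defs
begin

section \<open>Global existence of Caratheodory solutions\<close>

lemma continuous_on_atLeastI:
  fixes g :: "real \<Rightarrow> 'a::topological_space"
  assumes "\<And>T. 0 \<le> T \<Longrightarrow> continuous_on {0..T} g"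
  shows "continuous_on {0..} g"
  unfolding continuous_on_eq_continuous_within
proof
  fix t :: real
  assume t: "t \<in> {0..}"
  \<comment> \<open>The interval has to extend beyond \<open>t\<close>: with right endpoint
    \<open>t\<close> only continuity from the left would follow.\<close>
  have "at t within {0..} = at t within {0..t+1}"
    by (rule at_within_nhd[of t "{..<t+1}"]) auto
  moreover have "continuous (at t within {0..t+1}) g"
    using assms[of "t+1"] t by (simp add: continuous_on_eq_continuous_within)
  ultimately show "continuous (at t within {0..}) g"
    by simp
qed

lemma continuous_on_indefinite_integral:
  fixes g :: "real \<Rightarrow> 'a::euclidean_space"
  assumes "\<And>T. 0 \<le> T \<Longrightarrow> g integrable_on {0..T}"
  shows "continuous_on {0..} (\<lambda>t. integral {0..t} g)"
  by (intro continuous_on_atLeastI indefinite_integral_continuous_1 assms)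

text \<open>A weight rate of twice the Lipschitz constant leaves a factor 1/2 after integration;
  this becomes the contraction constant of the Picard operator.\<close>

lemma integral_exp_le:
  fixes L t :: real
  assumes "L > 0" "t \<ge> 0"
  shows "integral {0..t} (\<lambda>s. L * (exp (2 * L * s) * d)) = (exp (2 * L * t) - 1) / 2 * d"
proof -
  have "((\<lambda>s. L * (exp (2 * L * s) * d)) has_integral
      exp (2 * L * t) / 2 * d - exp (2 * L * 0) / 2 * d) {0..t}"
    using assms(2)
    by (intro fundamental_theorem_of_calculus)
      (auto intro!: derivative_eq_intros simp flip: has_real_derivative_iff_has_vector_derivative)
  from integral_unique[OF this] show ?thesis
    by (simp add: diff_divide_distrib left_diff_distrib)
qed

text \<open>In the norm weighted by \<open>exp (- 2 * L * t)\<close> the Picard operator is a contraction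
  on the whole half-line, so no continuation argument is needed. The unknown is
  \<open>y t = x t + integral {0..t} w\<close>, for which the right-hand side is continuous in time.\<close>

lemma caratheodory_solution_exists:
  fixes f :: "'a::euclidean_space \<Rightarrow> 'a" and w :: "real \<Rightarrow> 'a"
  assumes L: "L > 0" and lip: "\<And>x y. norm (f x - f y) \<le> L * norm (x - y)"
    and bdd: "\<And>x. norm (f x) \<le> K"
    and w: "\<And>T. 0 \<le> T \<Longrightarrow> w integrable_on {0..T}"
  obtains x where "continuous_on {0..} x" "x 0 = x0"
    "\<And>t. 0 \<le> t \<Longrightarrow> ((\<lambda>s. f (x s) - w s) has_integral (x t - x0)) {0..t}"
proof -
  define W where "W t = integral {0..t} w" for t
  have W_cont: "continuous_on {0..} W"
    unfolding W_def by (intro continuous_on_indefinite_integral w)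
  have f_cont: "continuous_on UNIV f"
    using lip L by (intro lipschitz_on_continuous_on[where L = L])
      (auto simp: lipschitz_on_def dist_norm)
  \<comment> \<open>\<open>z\<close> stands for the weighted unknown
    \<open>exp (- 2 * L * t) * y t\<close>; undoing the weight and subtracting \<open>W\<close>
    recovers the state \<open>x\<close>, at which \<open>f\<close> is evaluated.\<close>
  define h where "h z s = f (exp (2 * L * s) *\<^sub>R apply_bcontfun z s - W s)"
    for z :: "real \<Rightarrow>\<^sub>C 'a" and s
  have z_cont: "continuous_on S (apply_bcontfun z)" for z :: "real \<Rightarrow>\<^sub>C 'a" and S
    by (rule continuous_on_subset[OF continuous_on_apply_bcontfun]) auto
  have h_cont: "continuous_on {0..} (h z)" for z
    unfolding h_def
    by (intro continuous_on_compose2[OF f_cont] continuous_intros z_cont W_cont) auto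
  have h_int: "h z integrable_on {0..t}" for z t
    by (rule integrable_continuous_interval) (rule continuous_on_subset[OF h_cont], auto)
  define I where "I z t = integral {0..t} (h z)" for z t
  have I_cont: "continuous_on {0..} (I z)" for z
    unfolding I_def by (intro continuous_on_indefinite_integral h_int)
  have "K \<ge> 0"
    using bdd[of 0] norm_ge_zero order_trans by blast
  have I_bound: "norm (I z t) \<le> K * t" if "t \<ge> 0" for z t
    unfolding I_def
    using integral_bound[OF that continuous_on_subset[OF h_cont], of z K] bdd
    by (simp add: h_def subset_iff)
  \<comment> \<open>Bounded continuous functions live on the whole real line, so
    \<open>max 0 t\<close> freezes the operator at its value at 0 for negative times.\<close>
  define F where "F z t = exp (- (2 * L * max 0 t)) *\<^sub>R (x0 + I z (max 0 t))" for z t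
  have F_cont: "continuous_on UNIV (F z)" for z
    unfolding F_def
    by (intro continuous_intros continuous_on_compose2[OF I_cont]) auto
  have F_bound: "norm (F z t) \<le> norm x0 + K / (2 * L)" for z t
  proof -
    define s where "s = max 0 t"
    have s: "s \<ge> 0" by (simp add: s_def)
    \<comment> \<open>The integral term grows at most linearly in time, and the exponential weight
      absorbs this growth.\<close>
    have e: "exp (- (2 * L * s)) * (2 * L * s) \<le> 1"
    proof -
      have "2 * L * s \<le> exp (2 * L * s)"
        using exp_ge_add_one_self[of "2 * L * s"] by linarith
      then show ?thesis
        by (simp add: exp_minus field_simps)
    qed
    have "norm (F z t) = exp (- (2 * L * s)) * norm (x0 + I z s)"
      by (simp add: F_def flip: s_def)
    also have "\<dots> \<le> exp (- (2 * L * s)) * (norm x0 + K * s)"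
      using I_bound[OF s, of z] by (intro mult_left_mono norm_triangle_le) auto
    also have "\<dots> = exp (- (2 * L * s)) * norm x0
        + exp (- (2 * L * s)) * (2 * L * s) * (K / (2 * L))"
      using L by (simp add: field_simps)
    also have "\<dots> \<le> 1 * norm x0 + 1 * (K / (2 * L))"
      using L s \<open>K \<ge> 0\<close> e by (intro add_mono mult_right_mono) auto
    finally show ?thesis by simp
  qed
  have F_bcontfun: "F z \<in> bcontfun" for z
    using F_cont F_bound by (auto simp: bcontfun_def bounded_iff)
  define \<Phi> where "\<Phi> z = Bcontfun (F z)" for z
  have \<Phi>: "apply_bcontfun (\<Phi> z) = F z" for z
    unfolding \<Phi>_def by (rule Bcontfun_inverse[OF F_bcontfun])
  have contr: "dist (\<Phi> z1) (\<Phi> z2) \<le> 1/2 * dist z1 z2" for z1 z2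
  proof (rule dist_bound)
    fix t :: real
    define s where "s = max 0 t"
    define d where "d = dist z1 z2"
    have s: "s \<ge> 0" by (simp add: s_def)
    have pt: "norm (h z1 r - h z2 r) \<le> L * (exp (2 * L * r) * d)" for r
    proof -
      have "norm (h z1 r - h z2 r)
          \<le> L * norm ((exp (2 * L * r) *\<^sub>R apply_bcontfun z1 r - W r)
              - (exp (2 * L * r) *\<^sub>R apply_bcontfun z2 r - W r))"
        unfolding h_def by (rule lip)
      also have "\<dots> = L * (exp (2 * L * r) * dist (apply_bcontfun z1 r) (apply_bcontfun z2 r))"
        by (simp add: dist_norm flip: scaleR_diff_right)
      also have "\<dots> \<le> L * (exp (2 * L * r) * d)"
        unfolding d_def using L by (intro mult_left_mono dist_bounded) auto
      finally show ?thesis .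
    qed
    have "norm (I z1 s - I z2 s) = norm (integral {0..s} (\<lambda>r. h z1 r - h z2 r))"
      by (simp add: I_def h_int integral_diff)
    also have "\<dots> \<le> integral {0..s} (\<lambda>r. L * (exp (2 * L * r) * d))"
      by (intro integral_norm_bound_integral pt integrable_diff h_int
          integrable_continuous_interval continuous_intros)
    also have "\<dots> = (exp (2 * L * s) - 1) / 2 * d"
      using L s by (rule integral_exp_le)
    also have "\<dots> \<le> exp (2 * L * s) / 2 * d"
      by (intro mult_right_mono) (auto simp: d_def)
    finally have "exp (- (2 * L * s)) * norm (I z1 s - I z2 s)
        \<le> exp (- (2 * L * s)) * (exp (2 * L * s) / 2 * d)"
      by (intro mult_left_mono) auto
    also have "\<dots> = 1/2 * d"
      by (simp add: exp_minus field_simps)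
    finally show "dist (apply_bcontfun (\<Phi> z1) t) (apply_bcontfun (\<Phi> z2) t) \<le> 1/2 * dist z1 z2"
      by (simp add: \<Phi> F_def dist_norm s_def d_def flip: scaleR_diff_right)
  qed
  have "\<exists>!z. \<Phi> z = z"
    using contr by (intro banach_fix_type[of "1/2"]) auto
  then obtain z where z: "\<Phi> z = z" by blast
  define x where "x t = exp (2 * L * t) *\<^sub>R apply_bcontfun z t - W t" for t
  have x_eq: "x t = x0 + I z t - W t" if "t \<ge> 0" for t
  proof -
    have "apply_bcontfun z t = exp (- (2 * L * t)) *\<^sub>R (x0 + I z t)"
      using \<Phi>[of z] that by (simp add: z F_def max_def)
    then show ?thesis
      by (simp add: x_def flip: exp_add)
  qed
  show thesis
  proof
    show "continuous_on {0..} x"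
      unfolding x_def by (intro continuous_intros z_cont W_cont)
    show "x 0 = x0"
      by (simp add: x_eq I_def W_def)
    fix t :: real
    assume t: "0 \<le> t"
    have "(h z has_integral I z t) {0..t}"
      unfolding I_def by (rule integrable_integral[OF h_int])
    moreover have "(w has_integral W t) {0..t}"
      unfolding W_def by (rule integrable_integral[OF w[OF t]])
    ultimately have "((\<lambda>s. h z s - w s) has_integral I z t - W t) {0..t}"
      by (rule has_integral_diff)
    then show "((\<lambda>s. f (x s) - w s) has_integral (x t - x0)) {0..t}"
      using x_eq[OF t] by (simp add: h_def x_def)
  qed
qed


section \<open>Quadratic forms, ellipsoids and Young's inequality\<close>

lemma inner_symmetric_matrix:
  fixes A :: "real^'n^'n"
  assumes "transpose A = A"
  shows "x \<bullet> (A *v y) = (A *v x) \<bullet> y"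
  by (metis assms dot_lmul_matrix transpose_matrix_vector)

lemma quad_form_add:
  assumes "transpose A = A"
  shows "quad_form A (x + y) = quad_form A x + 2 * (x \<bullet> (A *v y)) + quad_form A y"
  using inner_symmetric_matrix[OF assms, of x y]
  by (simp add: quad_form_def matrix_vector_right_distrib inner_add_left inner_add_right
      inner_commute)

text \<open>Symmetry cancels the two mixed terms. This exact factorization of an increment replaces
  the chain rule along trajectories.\<close>

lemma quad_form_diff_factor:
  assumes "transpose A = A"
  shows "quad_form A x - quad_form A y = (x - y) \<bullet> (A *v (x + y))"
  using inner_symmetric_matrix[OF assms, of x y]
  by (simp add: quad_form_def matrix_vector_right_distrib inner_add_right inner_diff_left)
    (simp add: inner_commute)

lemma quad_form_scaleR: "quad_form A (c *\<^sub>R x) = c\<^sup>2 * quad_form A x"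
  by (simp add: quad_form_def matrix_vector_mult_scaleR power2_eq_square)

lemma continuous_on_matrix_vector_mult [continuous_intros]:
  fixes A :: "real^'n^'m"
  assumes "continuous_on S g"
  shows "continuous_on S (\<lambda>x. A *v g x)"
  by (rule bounded_linear.continuous_on[OF matrix_vector_mul_bounded_linear assms])

lemma continuous_on_quad_form [continuous_intros]:
  assumes "continuous_on S g"
  shows "continuous_on S (\<lambda>x. quad_form A (g x))"
  unfolding quad_form_def by (intro continuous_intros assms)

text \<open>The constant is the minimum of the form on the compact unit sphere; homogeneity of
  degree 2 carries the bound to all vectors.\<close>

lemma sym_pos_def_coercive:
  fixes P :: "real^'n^'n"
  assumes "sym_pos_def P"
  obtains c where "c > 0" "\<And>x. c * (norm x)\<^sup>2 \<le> quad_form P x"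
proof -
  let ?S = "sphere (0::real^'n) 1"
  have ne: "?S \<noteq> {}"
    by simp
  have "continuous_on ?S (quad_form P)"
    by (intro continuous_intros)
  then obtain u where u: "u \<in> ?S" and min: "\<And>y. y \<in> ?S \<Longrightarrow> quad_form P u \<le> quad_form P y"
    using continuous_attains_inf[OF compact_sphere ne] by blast
  show thesis
  proof
    have "u \<noteq> 0"
      using u by auto
    then show "quad_form P u > 0"
      using assms by (simp add: sym_pos_def_def)
    fix x :: "real^'n"
    show "quad_form P u * (norm x)\<^sup>2 \<le> quad_form P x"
    proof (cases "x = 0")
      case False
      have "quad_form P u \<le> quad_form P ((1 / norm x) *\<^sub>R x)"
        using False by (intro min) simp
      then show ?thesis
        using False by (simp add: quad_form_scaleR power_divide pos_le_divide_eq)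
    qed (simp add: quad_form_def)
  qed
qed

lemma sym_pos_def_nonneg: "sym_pos_def P \<Longrightarrow> 0 \<le> quad_form P x"
  by (cases "x = 0") (auto simp: sym_pos_def_def quad_form_def less_imp_le)

lemma compact_ellipsoid:
  assumes "sym_pos_def P"
  shows "compact (ellipsoid P \<xi>)"
proof -
  obtain c where c: "c > 0" "\<And>x. c * (norm x)\<^sup>2 \<le> quad_form P x"
    using sym_pos_def_coercive[OF assms] by blast
  have "norm x \<le> sqrt (\<xi> / c)" if "x \<in> ellipsoid P \<xi>" for x
  proof (rule real_le_rsqrt)
    show "(norm x)\<^sup>2 \<le> \<xi> / c"
      using c(2)[of x] c(1) that by (simp add: ellipsoid_def pos_le_divide_eq mult.commute)
  qed
  then have "bounded (ellipsoid P \<xi>)"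
    by (auto simp: bounded_iff)
  moreover have "closed (ellipsoid P \<xi>)"
    unfolding ellipsoid_def by (intro closed_Collect_le continuous_intros)
  ultimately show ?thesis
    by (simp add: compact_eq_bounded_closed)
qed

lemma sym_pos_def_matrix_inv:
  fixes P :: "real^'n^'n"
  assumes "sym_pos_def P"
  shows "P ** matrix_inv P = mat 1" "matrix_inv P ** P = mat 1"
proof -
  have "x = 0" if "P *v x = 0" for x
    using assms that by (force simp: sym_pos_def_def quad_form_def)
  then obtain A where "A ** P = mat 1"
    using matrix_left_invertible_ker[of P] by blast
  then have "P ** A = mat 1 \<and> A ** P = mat 1"
    using matrix_left_right_inverse by blast
  \<comment> \<open>\<open>matrix_inv\<close> is a choice term for a two-sided inverse, so
    exhibiting one such inverse is what gives access to its properties.\<close>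
  then have "P ** matrix_inv P = mat 1 \<and> matrix_inv P ** P = mat 1"
    unfolding matrix_inv_def by (rule someI)
  then show "P ** matrix_inv P = mat 1" "matrix_inv P ** P = mat 1"
    by auto
qed

lemma matrix_inv_cancel:
  fixes P :: "real^'n^'n"
  assumes "sym_pos_def P"
  shows "P *v (matrix_inv P *v x) = x" "matrix_inv P *v (P *v x) = x"
  by (simp_all add: matrix_vector_mul_assoc sym_pos_def_matrix_inv[OF assms])

text \<open>Completing the square: \<open>v\<close> is chosen so that the cross term of
  \<open>quad_form R (w + v)\<close> is \<open>(1 / \<alpha>) * (w \<bullet> c)\<close>, and the
  nonnegative form is then multiplied by \<alpha>. For \<open>c = 2 *\<^sub>R (P *v x)\<close> the
  coefficient \<open>1 / (4 * \<alpha>)\<close> turns into the \<open>1 / \<alpha>\<close> of the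
  LMI.\<close>

lemma inner_le_young:
  fixes R :: "real^'n^'n"
  assumes R: "sym_pos_def R" and w: "w \<in> ellipsoid R 1" and \<alpha>: "\<alpha> > 0"
  shows "- (w \<bullet> c) \<le> \<alpha> + 1 / (4 * \<alpha>) * quad_form (matrix_inv R) c"
proof -
  define v where "v = (1 / (2 * \<alpha>)) *\<^sub>R (matrix_inv R *v c)"
  have Rv: "R *v v = (1 / (2 * \<alpha>)) *\<^sub>R c"
    by (simp add: v_def matrix_vector_mult_scaleR matrix_inv_cancel[OF R])
  have qv: "quad_form R v = (1 / (4 * \<alpha>\<^sup>2)) * quad_form (matrix_inv R) c"
    unfolding quad_form_def Rv
    by (simp add: v_def inner_commute power2_eq_square)
  have "0 \<le> quad_form R (w + v)"
    by (rule sym_pos_def_nonneg[OF R])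
  also have "\<dots> = quad_form R w + (1 / \<alpha>) * (w \<bullet> c) + (1 / (4 * \<alpha>\<^sup>2)) * quad_form (matrix_inv R) c"
    using R by (simp add: quad_form_add sym_pos_def_def Rv qv)
  also have "\<dots> \<le> 1 + (1 / \<alpha>) * (w \<bullet> c) + (1 / (4 * \<alpha>\<^sup>2)) * quad_form (matrix_inv R) c"
    using w by (simp add: ellipsoid_def)
  finally have "0 \<le> \<alpha> * (1 + (1 / \<alpha>) * (w \<bullet> c) + (1 / (4 * \<alpha>\<^sup>2)) * quad_form (matrix_inv R) c)"
    using \<alpha> by simp
  also have "\<dots> = \<alpha> + w \<bullet> c + 1 / (4 * \<alpha>) * quad_form (matrix_inv R) c"
    using \<alpha> by (simp add: field_simps power2_eq_square)
  finally show ?thesis by simp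
qed

section \<open>Lyapunov barrier and distance to the target\<close>

lemma last_zero_before_positive:
  fixes D :: "real \<Rightarrow> real"
  assumes cont: "continuous_on {a..b} D" and "a \<le> b" "D a \<le> 0" "D b > 0"
  obtains t0 where "a \<le> t0" "t0 < b" "D t0 = 0" "\<And>t. t0 < t \<Longrightarrow> t \<le> b \<Longrightarrow> D t > 0"
proof -
  define S where "S = {t \<in> {a..b}. D t \<le> 0}"
  have "S = {a..b} \<inter> D -` {..0}"
    by (auto simp: S_def)
  then have "closed S"
    using continuous_closed_preimage[OF cont closed_atLeastAtMost closed_atMost] by simp
  moreover have "bounded S"
    by (rule bounded_subset[of "{a..b}"]) (auto simp: S_def)
  ultimately have "compact S"
    by (simp add: compact_eq_bounded_closed)
  moreover have "S \<noteq> {}"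
    using assms by (auto simp: S_def)
  ultimately obtain t0 where t0: "t0 \<in> S" "\<And>t. t \<in> S \<Longrightarrow> t \<le> t0"
    by (meson compact_attains_sup)
  have pos: "D t > 0" if "t0 < t" "t \<le> b" for t
  proof (rule ccontr)
    assume "\<not> D t > 0"
    then have "t \<in> S"
      using t0(1) that by (simp add: S_def)
    then show False
      using t0(2)[of t] that by simp
  qed
  have lt: "t0 < b"
    using t0(1) \<open>D b > 0\<close> by (cases "t0 = b") (auto simp: S_def)
  \<comment> \<open>A negative value at the maximum \<open>t0\<close> of \<open>S\<close> would, by
    the intermediate value theorem, produce a zero after \<open>t0\<close>, where \<open>D\<close>
    is positive.\<close>
  have "D t0 = 0"
  proof (rule ccontr)
    assume "D t0 \<noteq> 0"
    then have "D t0 < 0"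
      using t0(1) by (auto simp: S_def)
    moreover have "continuous_on {t0..b} D"
      using t0(1) by (intro continuous_on_subset[OF cont]) (auto simp: S_def)
    ultimately obtain t where "t0 \<le> t" "t \<le> b" "D t = 0"
      using IVT'[of D t0 0 b] \<open>D b > 0\<close> lt by auto
    then show False
      using pos[of t] \<open>D t0 < 0\<close> by (cases "t = t0") auto
  qed
  then show thesis
    using that[of t0] t0(1) lt pos by (auto simp: S_def)
qed

text \<open>Barrier argument: \<open>V = quad_form P \<circ> x\<close> stays below
  \<open>U t = 1 + (\<xi> - 1) * exp (- \<alpha> * t)\<close>, the solution of \<open>U' = \<alpha> * (1 - U)\<close>. At the last
  zero of \<open>V - U\<close> the state lies in the set where the hypothesis \<open>decay\<close> is available, and its
  strictness forces \<open>V \<le> U\<close> on a further interval. Since \<open>w\<close> is merely measurable, \<open>V\<close> need not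
  be differentiable; its increments are factored as \<open>(x b - x a) \<bullet> P *v (x b + x a)\<close> instead.\<close>

lemma lyapunov_barrier:
  fixes P R :: "real^'n^'n" and x w :: "real \<Rightarrow> real^'n"
  assumes P: "sym_pos_def P" and R: "sym_pos_def R" and \<alpha>: "\<alpha> > 0"
    and f: "continuous_on UNIV f" and x: "continuous_on {0..} x"
    and w: "\<And>t. 0 \<le> t \<Longrightarrow> w t \<in> ellipsoid R 1"
    and int: "\<And>t. 0 \<le> t \<Longrightarrow> ((\<lambda>s. f (x s) - w s) has_integral (x t - x 0)) {0..t}"
    and \<xi>: "quad_form P (x 0) = \<xi>" "\<xi> \<ge> 1"
    and decay: "\<And>y. \<lbrakk>1 \<le> quad_form P y; quad_form P y \<le> \<xi>\<rbrakk> \<Longrightarrow>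
      2 * (f y \<bullet> (P *v y)) + 1 / \<alpha> * quad_form (matrix_inv R) (P *v y) + \<alpha> * quad_form P y < 0"
    and t: "0 \<le> t"
  shows "quad_form P (x t) \<le> 1 + (\<xi> - 1) * exp (- (\<alpha> * t))"
proof (rule ccontr)
  assume neg: "\<not> ?thesis"
  define U where "U t = 1 + (\<xi> - 1) * exp (- (\<alpha> * t))" for t
  define D where "D t = quad_form P (x t) - U t" for t
  have "continuous_on {0..t} D"
    unfolding D_def U_def
    by (intro continuous_intros continuous_on_subset[OF x]) auto
  moreover have "D 0 \<le> 0" "D t > 0"
    using neg \<xi> by (auto simp: D_def U_def)
  ultimately obtain t0 where t0: "0 \<le> t0" "t0 < t" "D t0 = 0"
    and pos: "\<And>s. t0 < s \<Longrightarrow> s \<le> t \<Longrightarrow> D s > 0"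
    using last_zero_before_positive[of 0 t D] t by blast
  have V0: "quad_form P (x t0) = U t0"
    using t0(3) by (simp add: D_def)
  have "exp (- (\<alpha> * t0)) \<le> 1"
    using \<alpha> t0(1) by simp
  then have U_bounds: "1 \<le> U t0" "U t0 \<le> \<xi>"
    using \<xi>(2) mult_left_mono[of "exp (- (\<alpha> * t0))" 1 "\<xi> - 1"] by (auto simp: U_def)
  \<comment> \<open>\<open>u\<close> is the slope of \<open>U\<close> at \<open>t0\<close>.\<close>
  define u where "u = \<alpha> * (1 - U t0)"
  define c where "c b = P *v (x b + x t0)" for b
  \<comment> \<open>\<open>\<Psi> (s, b)\<close> bounds \<open>(f (x s) - w s) \<bullet> c b\<close>
    once the demand has been removed by Young's inequality. Unlike that integrand it is continuous,
    so its strict bound on the diagonal at \<open>t0\<close> persists nearby.\<close>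
  define \<Psi> where "\<Psi> = (\<lambda>(s, b). f (x s) \<bullet> c b + (\<alpha> + 1 / (4 * \<alpha>) * quad_form (matrix_inv R) (c b)))"
  have \<Psi>_cont: "continuous_on ({0..} \<times> {0..}) \<Psi>"
    unfolding \<Psi>_def c_def split_beta
    by (intro continuous_intros continuous_on_compose2[OF f] continuous_on_compose2[OF x]) auto
  have "c t0 = 2 *\<^sub>R (P *v x t0)"
    by (simp only: c_def matrix_vector_right_distrib scaleR_2)
  then have "\<Psi> (t0, t0) = 2 * (f (x t0) \<bullet> (P *v x t0))
      + 1 / \<alpha> * quad_form (matrix_inv R) (P *v x t0) + \<alpha>"
    by (simp add: \<Psi>_def quad_form_scaleR power2_eq_square)
  then have "\<Psi> (t0, t0) < u"
    using decay[of "x t0"] U_bounds V0 by (simp add: u_def right_diff_distrib)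
  then obtain \<delta> where \<delta>: "\<delta> > 0"
    and near: "\<And>p. p \<in> {0..} \<times> {0..} \<Longrightarrow> dist p (t0, t0) < \<delta> \<Longrightarrow> dist (\<Psi> p) (\<Psi> (t0, t0)) < u - \<Psi> (t0, t0)"
    using \<Psi>_cont t0(1) unfolding continuous_on_iff
    by (metis atLeast_iff diff_gt_0_iff_gt mem_Sigma_iff)
  \<comment> \<open>Both coordinates of \<open>(s, b)\<close> are then within \<delta>/3 of
    \<open>t0\<close>, so their sum of distances stays below \<delta>; the cap at \<open>t\<close>
    keeps \<open>b\<close> where \<open>D\<close> is positive.\<close>
  define b where "b = min t (t0 + \<delta> / 3)"
  have b: "t0 < b" "b \<le> t" "b - t0 < \<delta> / 2"
    using t0 \<delta> by (auto simp: b_def min_def)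
  have \<Psi>_le: "\<Psi> (s, b) \<le> u" if "s \<in> {t0..b}" for s
  proof -
    have "dist (s, b) (t0, t0) \<le> dist s t0 + dist b t0"
      unfolding dist_Pair_Pair by (intro sqrt_sum_squares_le_sum) auto
    also have "\<dots> < \<delta>"
      using that b by (simp add: dist_real_def)
    finally have "dist (\<Psi> (s, b)) (\<Psi> (t0, t0)) < u - \<Psi> (t0, t0)"
      using near[of "(s, b)"] that t0(1) by auto
    then show ?thesis
      by (simp add: dist_real_def abs_less_iff)
  qed
  have "((\<lambda>s. f (x s) - w s) has_integral (x b - x t0)) {t0..b}"
  proof -
    have "(\<lambda>s. f (x s) - w s) integrable_on {t0..b}"
      using int[of b] b t0(1) by (auto intro: integrable_on_subinterval)
    then obtain y where y: "((\<lambda>s. f (x s) - w s) has_integral y) {t0..b}"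
      by blast
    have "((\<lambda>s. f (x s) - w s) has_integral (x t0 - x 0 + y)) {0..b}"
      using t0(1) b by (intro has_integral_combine[OF _ _ int y]) auto
    then have "x t0 - x 0 + y = x b - x 0"
      using int[of b] b t0(1) by (intro has_integral_unique) auto
    then have "y = x b - x t0"
      by (simp add: algebra_simps)
    with y show ?thesis by simp
  qed
  from has_integral_linear[OF this bounded_linear_inner_left[of "c b"]]
  have "((\<lambda>s. (f (x s) - w s) \<bullet> c b) has_integral (x b - x t0) \<bullet> c b) {t0..b}"
    by (simp add: o_def)
  moreover have "((\<lambda>s. u) has_integral (b - t0) *\<^sub>R u) {t0..b}"
    using has_integral_const_real[of u t0 b] b by simp
  moreover have "(f (x s) - w s) \<bullet> c b \<le> u" if "s \<in> {t0..b}" for s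
  proof -
    have "- (w s \<bullet> c b) \<le> \<alpha> + 1 / (4 * \<alpha>) * quad_form (matrix_inv R) (c b)"
      using that t0(1) by (intro inner_le_young[OF R _ \<alpha>] w) auto
    then show ?thesis
      using \<Psi>_le[OF that] by (simp add: \<Psi>_def inner_diff_left)
  qed
  ultimately have "(x b - x t0) \<bullet> c b \<le> (b - t0) *\<^sub>R u"
    by (rule has_integral_le)
  moreover have "quad_form P (x b) - quad_form P (x t0) = (x b - x t0) \<bullet> c b"
    unfolding c_def using P by (intro quad_form_diff_factor) (simp add: sym_pos_def_def)
  ultimately have "quad_form P (x b) - quad_form P (x t0) \<le> (b - t0) * u"
    by simp
  \<comment> \<open>\<open>U\<close> is convex because \<open>\<xi> \<ge> 1\<close>, so it lies
    above its tangent at \<open>t0\<close>.\<close>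
  also have "\<dots> \<le> U b - U t0"
  proof -
    have "exp (- (\<alpha> * t0)) * (1 - \<alpha> * (b - t0)) \<le> exp (- (\<alpha> * t0)) * exp (- (\<alpha> * (b - t0)))"
      using exp_ge_add_one_self[of "- (\<alpha> * (b - t0))"] by (intro mult_left_mono) auto
    also have "\<dots> = exp (- (\<alpha> * b))"
      by (simp add: algebra_simps flip: exp_add)
    finally have "(\<xi> - 1) * (exp (- (\<alpha> * t0)) * (1 - \<alpha> * (b - t0))) \<le> (\<xi> - 1) * exp (- (\<alpha> * b))"
      using \<xi>(2) by (intro mult_left_mono) auto
    then show ?thesis
      by (simp add: u_def U_def algebra_simps)
  qed
  finally have "D b \<le> D t0"
    by (simp add: D_def)
  then show False
    using pos[of b] b t0(3) by simp
qed

text \<open>The radial projection \<open>(1 / r) *\<^sub>R x\<close> lies in the target, and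
  \<open>1 - 1 / r\<close> is at most \<open>r\<^sup>2 - 1\<close>. Decay of the Lyapunov function
  thereby becomes decay of the distance on bounded sets.\<close>

lemma infdist_ellipsoid_le:
  assumes P: "sym_pos_def P" and V: "1 \<le> quad_form P x"
  shows "infdist x (ellipsoid P 1) \<le> norm x * (quad_form P x - 1)"
proof -
  define r where "r = sqrt (quad_form P x)"
  have r: "r \<ge> 1" "r\<^sup>2 = quad_form P x"
    using V by (simp_all add: r_def)
  have "(1 / r) *\<^sub>R x \<in> ellipsoid P 1"
    using r V by (simp add: ellipsoid_def quad_form_scaleR power_divide)
  then have "infdist x (ellipsoid P 1) \<le> dist x ((1 / r) *\<^sub>R x)"
    by (rule infdist_le)
  also have "\<dots> = norm ((1 - 1 / r) *\<^sub>R x)"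
    by (simp add: dist_norm scaleR_diff_left)
  also have "\<dots> = norm x * (1 - 1 / r)"
    using r by simp
  also have "\<dots> \<le> norm x * (quad_form P x - 1)"
  proof (rule mult_left_mono)
    have "1 - 1 / r \<le> r - 1"
      using zero_le_power2[of "r - 1"] r(1) by (simp add: field_simps power2_eq_square)
    also have "\<dots> \<le> r\<^sup>2 - 1"
      using r(1) by (simp add: power2_eq_square mult_le_cancel_left1)
    finally show "1 - 1 / r \<le> quad_form P x - 1"
      by (simp add: r)
  qed simp
  finally show ?thesis .
qed

section \<open>Degrees of saturation and the vertex matrices\<close>

lemma sat_degree_eq:
  assumes "umin $ i < 0" "0 < umax $ i"
  shows "sat_degree k H umin umax i x =
    1 / max 1 (max (- k * (row i H \<bullet> x) / umin $ i) (- k * (row i H \<bullet> x) / umax $ i))"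
proof -
  define z where "z = - k * (row i H \<bullet> x)"
  consider "z < umin $ i" | "umin $ i \<le> z" "z \<le> umax $ i" | "umax $ i < z"
    by linarith
  then have "(if z < umin $ i then umin $ i / z else if z \<le> umax $ i then 1 else umax $ i / z)
      = 1 / max 1 (max (z / umin $ i) (z / umax $ i))"
  proof cases
    case 1
    then have "z / umin $ i > 1" "z / umax $ i \<le> 0"
      using assms by (auto simp: field_simps)
    with 1 show ?thesis by (simp add: max_def)
  next
    case 2
    then have "z / umin $ i \<le> 1" "z / umax $ i \<le> 1"
      using assms by (auto simp: field_simps)
    with 2 show ?thesis by (simp add: max_def)
  next
    case 3
    then have "z / umax $ i > 1" "z / umin $ i \<le> 0"
      using assms by (auto simp: field_simps)
    then have "max 1 (max (z / umin $ i) (z / umax $ i)) = z / umax $ i"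
      by linarith
    with 3 assms show ?thesis by simp
  qed
  then show ?thesis
    unfolding sat_degree_def Let_def z_def .
qed

text \<open>When a bound is active, the unsaturated input is nonzero because the bounds have strict
  signs, so the quotient in the degree cancels.\<close>

lemma sat_eq_sat_degree_mult:
  assumes "umin $ i < 0" "0 < umax $ i"
  shows "sat_feedback k H umin umax x $ i = sat_degree k H umin umax i x * (- k * (row i H \<bullet> x))"
  using assms by (auto simp: sat_feedback_def sat_def sat_degree_def Let_def)

lemma sat_degree_le_1:
  assumes "umin $ i < 0" "0 < umax $ i"
  shows "sat_degree k H umin umax i x \<le> 1"
  unfolding sat_degree_eq[OF assms] by (simp add: field_simps)

lemma min_sat_degree_le:
  assumes u: "umin $ i < 0" "0 < umax $ i" and P: "sym_pos_def P" and x: "x \<in> ellipsoid P \<xi>"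
  shows "min_sat_degree k H umin umax P \<xi> i \<le> sat_degree k H umin umax i x"
proof -
  have "continuous_on (ellipsoid P \<xi>) (sat_degree k H umin umax i)"
    \<comment> \<open>The closed form has a denominator of at least 1, which makes continuity across
      the three cases immediate.\<close>
    unfolding sat_degree_eq[OF u, abs_def] using u
    by (intro continuous_intros) (auto simp: max_def)
  then obtain y where y: "y \<in> ellipsoid P \<xi>"
    "\<And>x. x \<in> ellipsoid P \<xi> \<Longrightarrow> sat_degree k H umin umax i y \<le> sat_degree k H umin umax i x"
    using continuous_attains_inf[OF compact_ellipsoid[OF P]] x by blast
  then have "min_sat_degree k H umin umax P \<xi> i = sat_degree k H umin umax i y"
    unfolding min_sat_degree_def by (intro Least_equality) auto
  with y(2)[OF x] show ?thesis by simp
qed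

lemma sat_nonexpansive: "a \<le> b \<Longrightarrow> \<bar>sat a b y - sat a b z\<bar> \<le> \<bar>y - z\<bar>"
  by (auto simp: sat_def)

lemma sat_feedback_lipschitz:
  assumes "\<forall>i. umin $ i < 0 \<and> 0 < umax $ i"
  obtains L where "L \<ge> 0"
    "\<And>x y. norm (sat_feedback k H umin umax x - sat_feedback k H umin umax y) \<le> L * norm (x - y)"
proof
  let ?L = "\<Sum>i\<in>UNIV. \<bar>k\<bar> * norm (row i H)"
  show "?L \<ge> 0"
    by (intro sum_nonneg) auto
  fix x y
  have le: "umin $ i \<le> umax $ i" for i
    using assms by (meson less_imp_le order_trans)
  have "norm (sat_feedback k H umin umax x - sat_feedback k H umin umax y)
      \<le> (\<Sum>i\<in>UNIV. \<bar>(sat_feedback k H umin umax x - sat_feedback k H umin umax y) $ i\<bar>)"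
    by (rule norm_le_l1_cart)
  also have "\<dots> \<le> (\<Sum>i\<in>UNIV. \<bar>k\<bar> * norm (row i H) * norm (x - y))"
  proof (rule sum_mono)
    fix i
    have "\<bar>(sat_feedback k H umin umax x - sat_feedback k H umin umax y) $ i\<bar>
        \<le> \<bar>- k * (row i H \<bullet> x) - - k * (row i H \<bullet> y)\<bar>"
      using sat_nonexpansive[OF le] by (simp only: sat_feedback_def vector_minus_component vec_lambda_beta)
    also have "\<dots> = \<bar>k\<bar> * \<bar>row i H \<bullet> (x - y)\<bar>"
      by (simp add: inner_diff_right abs_mult[symmetric] algebra_simps abs_minus_commute)
    also have "\<dots> \<le> \<bar>k\<bar> * (norm (row i H) * norm (x - y))"
      by (intro mult_left_mono Cauchy_Schwarz_ineq2) auto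
    finally show "\<bar>(sat_feedback k H umin umax x - sat_feedback k H umin umax y) $ i\<bar>
        \<le> \<bar>k\<bar> * norm (row i H) * norm (x - y)"
      by (simp add: mult.assoc)
  qed
  finally show "norm (sat_feedback k H umin umax x - sat_feedback k H umin umax y) \<le> ?L * norm (x - y)"
    by (simp add: sum_distrib_right)
qed

lemma diag_mat_mult_vec: "(diag_mat d *v x) $ i = d $ i * x $ i"
  by (simp add: diag_mat_def matrix_vector_mult_def if_distrib[of "\<lambda>c. c * _"] cong: if_cong)

text \<open>The form separates into one summand per input component, each linear in its own gain;
  hence the gains can be optimised independently.\<close>

lemma inner_vertex_matrix:
  "z \<bullet> (vertex_matrix B k H umin umax P \<xi> J *v x) =
    (\<Sum>i\<in>UNIV. vertex_gain k H umin umax P \<xi> J $ i * ((z v* B) $ i * (- k * (row i H \<bullet> x))))"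
proof -
  have "z \<bullet> (vertex_matrix B k H umin umax P \<xi> J *v x) =
      - k * ((z v* B) \<bullet> (diag_mat (vertex_gain k H umin umax P \<xi> J) *v (H *v x)))"
    unfolding vertex_matrix_def
    by (simp only: dot_lmul_matrix inner_scaleR_right flip: scaleR_matrix_vector_assoc matrix_vector_mul_assoc)
  also have "\<dots> =
      - k * (\<Sum>i\<in>UNIV. (z v* B) $ i * (vertex_gain k H umin umax P \<xi> J $ i * (row i H \<bullet> x)))"
    unfolding inner_vec_def[of "z v* B"] diag_mat_mult_vec
    by (simp add: matrix_vector_mul_component row_def)
  finally show ?thesis
    by (simp add: sum_distrib_left mult_ac)
qed

text \<open>Since the vertices are the corners of a box, the maximising vertex is found
  componentwise; the sign of each summand decides between the two extreme gains.\<close>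

lemma worst_vertex:
  assumes u: "\<forall>i. umin $ i < 0 \<and> 0 < umax $ i" and P: "sym_pos_def P" and x: "x \<in> ellipsoid P \<xi>"
  obtains J where "z \<bullet> (B *v sat_feedback k H umin umax x) \<le> z \<bullet> (vertex_matrix B k H umin umax P \<xi> J *v x)"
proof
  let ?c = "\<lambda>i. (z v* B) $ i * (- k * (row i H \<bullet> x))"
  let ?J = "{i. ?c i < 0}"
  have "z \<bullet> (B *v sat_feedback k H umin umax x) = (z v* B) \<bullet> sat_feedback k H umin umax x"
    by (simp add: dot_lmul_matrix)
  also have "\<dots> = (\<Sum>i\<in>UNIV. sat_degree k H umin umax i x * ?c i)"
    using u by (simp add: inner_vec_def sat_eq_sat_degree_mult mult_ac)
  also have "\<dots> \<le> (\<Sum>i\<in>UNIV. vertex_gain k H umin umax P \<xi> ?J $ i * ?c i)"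
  proof (rule sum_mono)
    fix i
    have "umin $ i < 0" "0 < umax $ i"
      using u by auto
    note sd = sat_degree_le_1[OF this, of k H x] min_sat_degree_le[OF this P x, of k H]
    show "sat_degree k H umin umax i x * ?c i \<le> vertex_gain k H umin umax P \<xi> ?J $ i * ?c i"
    proof (cases "?c i < 0")
      case True
      then have gain: "vertex_gain k H umin umax P \<xi> ?J $ i = min_sat_degree k H umin umax P \<xi> i"
        by (simp add: vertex_gain_def)
      show ?thesis
        unfolding gain by (rule mult_right_mono_neg[OF sd(2) less_imp_le[OF True]])
    next
      case False
      then have gain: "vertex_gain k H umin umax P \<xi> ?J $ i = 1"
        by (simp add: vertex_gain_def)
      show ?thesis
        unfolding gain by (rule mult_right_mono[OF sd(1) leI[OF False]])
    qed
  qed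
  also have "\<dots> = z \<bullet> (vertex_matrix B k H umin umax P \<xi> ?J *v x)"
    by (rule inner_vertex_matrix[symmetric])
  finally show "z \<bullet> (B *v sat_feedback k H umin umax x)
      \<le> z \<bullet> (vertex_matrix B k H umin umax P \<xi> ?J *v x)" .
qed

text \<open>Congruence by \<open>P\<close> moves the LMI from \<open>Q\<close> to the Lyapunov
  function of \<open>P\<close>: with \<open>z = P *v x\<close> one has \<open>Q *v z = x\<close>,
  and the two terms containing \<open>A\<close> contribute equally.\<close>

lemma quad_form_lmi:
  fixes P :: "real^'n^'n"
  assumes P: "sym_pos_def P" and Q: "Q = matrix_inv P"
  shows "quad_form (Q ** transpose A + A ** Q + \<alpha> *\<^sub>R Q + \<beta> *\<^sub>R S) (P *v x) =
    2 * ((P *v x) \<bullet> (A *v x)) + \<alpha> * quad_form P x + \<beta> * quad_form S (P *v x)"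
proof -
  define z where "z = P *v x"
  have Qz: "Q *v z = x"
    by (simp add: z_def Q matrix_inv_cancel[OF P])
  have "z \<bullet> (Q *v y) = x \<bullet> y" for y
  proof -
    have "z \<bullet> (Q *v y) = x \<bullet> (P *v (Q *v y))"
      using P by (simp add: z_def inner_symmetric_matrix sym_pos_def_def)
    then show ?thesis
      by (simp add: Q matrix_inv_cancel[OF P])
  qed
  then have "z \<bullet> (Q *v (transpose A *v z)) = z \<bullet> (A *v x)"
    by (metis dot_lmul_matrix inner_commute transpose_matrix_vector)
  then show ?thesis
    unfolding z_def[symmetric]
    by (simp add: quad_form_def matrix_vector_mult_add_rdistrib inner_add_right Qz
        inner_commute z_def[symmetric] flip: matrix_vector_mul_assoc scaleR_matrix_vector_assoc)
qed

section \<open>Closed-loop existence and exponential convergence\<close>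

theorem theorem6:
  fixes B :: "real^'m^'n" and H :: "real^'n^'m"
    and P Q Rw :: "real^'n^'n"
    and umin umax :: "real^'m"
    and k \<xi> :: real and x0 :: "real^'n"
  assumes B_rational: "\<forall>i j. B $ i $ j \<in> \<rat>"
    and B_rank: "rank B = CARD('n)"
    and dims: "CARD('n) \<le> CARD('m)"
    and P: "sym_pos_def P"
    and Rw: "sym_pos_def Rw"
    and Q: "Q = matrix_inv P"
    and bounds: "\<forall>i. umin $ i < 0 \<and> 0 < umax $ i"
    and BH: "B ** H = mat 1"
    and xi: "\<xi> = quad_form P x0" "\<xi> \<ge> 1"
    and LMI: "\<exists>\<alpha>>0. \<forall>J :: 'm set.
      (let A = vertex_matrix B k H umin umax P \<xi> J in
       sym_neg_def (Q ** transpose A + A ** Q + \<alpha> *\<^sub>R Q + (1 / \<alpha>) *\<^sub>R matrix_inv Rw))"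
  shows "drives_within B (sat_feedback k H umin umax) (ellipsoid Rw 1) x0 (ellipsoid P 1)"
proof -
  obtain \<alpha> where \<alpha>: "\<alpha> > 0" and neg: "\<And>J. sym_neg_def
      (Q ** transpose (vertex_matrix B k H umin umax P \<xi> J) + vertex_matrix B k H umin umax P \<xi> J ** Q
        + \<alpha> *\<^sub>R Q + (1 / \<alpha>) *\<^sub>R matrix_inv Rw)"
    using LMI by (auto simp: Let_def)
  define f where "f x = B *v sat_feedback k H umin umax x" for x
  obtain K where K: "\<And>x. norm (f x) \<le> K"
  proof -
    have "bounded ((*v) B ` cbox umin umax)"
      by (intro bounded_linear_image bounded_cbox matrix_vector_mul_bounded_linear)
    then obtain K where K: "\<forall>v\<in>cbox umin umax. norm (B *v v) \<le> K"
      unfolding bounded_iff by blast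
    show thesis
    proof (rule that)
      show "norm (f x) \<le> K" for x
        unfolding f_def by (rule bspec[OF K sat_feedback_in_cbox[OF bounds]])
    qed
  qed
  obtain L where L: "L > 0" "\<And>x y. norm (f x - f y) \<le> L * norm (x - y)"
  proof -
    obtain L where L: "L \<ge> 0"
      "\<And>x y. norm (sat_feedback k H umin umax x - sat_feedback k H umin umax y) \<le> L * norm (x - y)"
      using sat_feedback_lipschitz[OF bounds, of k H] by blast
    obtain b where b: "b > 0" "\<And>v. norm (B *v v) \<le> norm v * b"
      using bounded_linear.pos_bounded[OF matrix_vector_mul_bounded_linear[of B]] by blast
    \<comment> \<open>The added 1 makes the Lipschitz constant strictly positive even when
      \<open>L = 0\<close>, as the weight in the existence lemma demands.\<close>
    have "norm (f x - f y) \<le> (L * b + 1) * norm (x - y)" for x y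
    proof -
      have "norm (f x - f y) \<le> norm (sat_feedback k H umin umax x - sat_feedback k H umin umax y) * b"
        unfolding f_def by (metis b(2) matrix_vector_mult_diff_distrib)
      also have "\<dots> \<le> (L * norm (x - y)) * b"
        using b(1) by (intro mult_right_mono L) auto
      finally show ?thesis
        by (simp add: algebra_simps add_increasing)
    qed
    then show thesis
      using that[of "L * b + 1"] L(1) b(1) by (simp add: add_nonneg_pos)
  qed
  have f_cont: "continuous_on UNIV f"
    using L by (intro lipschitz_on_continuous_on[where L = L])
      (auto simp: lipschitz_on_def dist_norm)
  have decay: "2 * (f y \<bullet> (P *v y)) + 1 / \<alpha> * quad_form (matrix_inv Rw) (P *v y)
      + \<alpha> * quad_form P y < 0" if y: "1 \<le> quad_form P y" "quad_form P y \<le> \<xi>" for y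
  proof -
    obtain J where J: "(P *v y) \<bullet> f y \<le> (P *v y) \<bullet> (vertex_matrix B k H umin umax P \<xi> J *v y)"
      unfolding f_def using y by (elim worst_vertex[OF bounds P, rotated]) (simp add: ellipsoid_def)
    \<comment> \<open>The LMI is strict only off the origin; \<open>quad_form P y \<ge> 1\<close>
      excludes the zero vector.\<close>
    have "P *v y \<noteq> 0"
      using y(1) by (auto simp: quad_form_def)
    then have "2 * ((P *v y) \<bullet> (vertex_matrix B k H umin umax P \<xi> J *v y)) + \<alpha> * quad_form P y
        + (1 / \<alpha>) * quad_form (matrix_inv Rw) (P *v y) < 0"
      using neg[of J] unfolding quad_form_lmi[OF P Q, symmetric] by (simp add: sym_neg_def_def)
    with J show ?thesis
      by (simp add: inner_commute)
  qed
  show ?thesis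
    unfolding drives_within_def
  proof (intro allI impI conjI)
    fix w
    assume w: "demand (ellipsoid Rw 1) w"
    \<comment> \<open>Compactness of the demand ellipsoid bounds \<open>w\<close>, so measurability
      suffices for integrability on bounded intervals.\<close>
    obtain C where C: "\<And>v. v \<in> ellipsoid Rw 1 \<Longrightarrow> norm v \<le> C"
      using compact_imp_bounded[OF compact_ellipsoid[OF Rw]] unfolding bounded_iff by blast
    have w_int: "w integrable_on {0..T}" if "0 \<le> T" for T
    proof (rule measurable_bounded_by_integrable_imp_integrable)
      show "w \<in> borel_measurable (lebesgue_on {0..T})"
        using w by (auto simp: demand_def intro: measurable_restrict_mono)
      show "(\<lambda>_. C) integrable_on {0..T}"
        by (rule integrable_const_ivl)
      show "norm (w t) \<le> C" if "t \<in> {0..T}" for t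
        using w that C by (auto simp: demand_def)
    qed simp
    show "\<exists>x. is_closed_loop_trajectory B (sat_feedback k H umin umax) w x0 x"
    proof -
      obtain x where "continuous_on {0..} x" "x 0 = x0"
        "\<And>t. 0 \<le> t \<Longrightarrow> ((\<lambda>s. f (x s) - w s) has_integral (x t - x0)) {0..t}"
        using caratheodory_solution_exists[OF L K w_int] by blast
      then show ?thesis
        by (auto simp: is_closed_loop_trajectory_def is_trajectory_def f_def)
    qed
    fix x
    assume "is_closed_loop_trajectory B (sat_feedback k H umin umax) w x0 x"
    then have x: "continuous_on {0..} x" "x 0 = x0"
      "\<And>t. 0 \<le> t \<Longrightarrow> ((\<lambda>s. f (x s) - w s) has_integral (x t - x 0)) {0..t}"
      by (auto simp: is_closed_loop_trajectory_def is_trajectory_def f_def)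
    have V: "quad_form P (x t) \<le> 1 + (\<xi> - 1) * exp (- (\<alpha> * t))" if "t \<ge> 0" for t
      using w x xi that
      by (intro lyapunov_barrier[OF P Rw \<alpha> f_cont x(1) _ x(3) _ _ decay]) (auto simp: demand_def)
    obtain C' where C': "\<And>v. v \<in> ellipsoid P \<xi> \<Longrightarrow> norm v \<le> C'"
      using compact_imp_bounded[OF compact_ellipsoid[OF P]] unfolding bounded_iff by blast
    have bound: "infdist (x t) (ellipsoid P 1) \<le> C' * ((\<xi> - 1) * exp (- (\<alpha> * t)))" if t: "t \<ge> 0" for t
    proof -
      \<comment> \<open>The barrier never exceeds \<xi>, so the state stays in the initial ellipsoid
        and \<open>C'\<close> bounds its norm uniformly in time.\<close>
      have "(\<xi> - 1) * exp (- (\<alpha> * t)) \<le> \<xi> - 1"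
        using \<alpha> t xi(2) by (intro mult_left_le) auto
      then have "norm (x t) \<le> C'"
        using V[OF t] by (intro C') (simp add: ellipsoid_def)
      then have "norm (x t) * ((\<xi> - 1) * exp (- (\<alpha> * t))) \<le> C' * ((\<xi> - 1) * exp (- (\<alpha> * t)))"
        using xi(2) by (intro mult_right_mono) auto
      moreover have "infdist (x t) (ellipsoid P 1) \<le> norm (x t) * ((\<xi> - 1) * exp (- (\<alpha> * t)))"
      proof (cases "1 \<le> quad_form P (x t)")
        case True
        have "norm (x t) * (quad_form P (x t) - 1) \<le> norm (x t) * ((\<xi> - 1) * exp (- (\<alpha> * t)))"
          using V[OF t] by (intro mult_left_mono) auto
        with infdist_ellipsoid_le[OF P True] show ?thesis
          by linarith
      next
        case False
        then have "x t \<in> ellipsoid P 1"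
          by (simp add: ellipsoid_def)
        then show ?thesis
          using xi(2) by simp
      qed
      ultimately show ?thesis
        by linarith
    qed
    show "((\<lambda>t. infdist (x t) (ellipsoid P 1)) \<longlongrightarrow> 0) at_top"
    proof (rule tendsto_sandwich[where f = "\<lambda>_. 0"])
      show "\<forall>\<^sub>F t in at_top. infdist (x t) (ellipsoid P 1) \<le> C' * ((\<xi> - 1) * exp (- (\<alpha> * t)))"
        using eventually_ge_at_top[of 0] by eventually_elim (rule bound)
      have "filterlim (\<lambda>t. \<alpha> * t) at_top at_top"
        using \<alpha> by (intro filterlim_tendsto_pos_mult_at_top[OF tendsto_const]) (auto intro: filterlim_ident)
      then have "((\<lambda>t. exp (- (\<alpha> * t))) \<longlongrightarrow> 0) at_top"
        by (intro filterlim_compose[OF exp_at_bot] filterlim_compose[OF filterlim_uminus_at_bot_at_top])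
      from tendsto_mult_left[OF tendsto_mult_left[OF this]]
      show "((\<lambda>t. C' * ((\<xi> - 1) * exp (- (\<alpha> * t)))) \<longlongrightarrow> 0) at_top"
        by fastforce
    qed (auto simp: infdist_nonneg)
  qed
qed

end
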